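(* Fix integers $3\le r\le k$ and let $u(n)$ satisfy $u(n)\to\infty$, $u(n)/n\to0$. Let $\mu$ be a constant with $0<\mu<\mu_{\mathrm c}(k,r):=\binom{k}{r}^{-1}\frac{(r-2)^{r-2}}{r(r-1)^{r-1}}$, and let $\tau^*$ be the unique solution in $(0,1/(r-2))$ of $\mu=\binom{k}{r}^{-1}\frac{\tau^*}{r(1+\tau^* )^{r-1}}$. Consider the random bipartite graph with $m=\lfloor\mu n^{r-1}/u(n)^{r-2}\rfloor$ constraint vertices. Then for any $\tau>\tau^*$, with probability $p(n,\mu,\tau)\to1$ the graph has a $(k-r+2)$-stopping set contained in $\{u(n)+1,\dots,n\}$ of size larger than $n-(1+\tau)u(n)$; moreover $$p(n,\mu,\tau)\ \ge\ 1-\exp\Bigl\{\inf_{\lambda>0,\ \tau'\in(0,\tau)}\varphi_{k,r}(\mu,\lambda,\tau')\,u(n)+O\bigl(\max\{1,u(n)^2/n\}\bigr)\Bigr\}.$$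
   Context: Random bipartite graph: variable vertices $[n]$, constraint vertices $[m]$; for each $a\in[m]$ independently, a $k$-tuple of pairwise distinct elements of $[n]$ is chosen uniformly among all $n(n-1)\cdots(n-k+1)$ such tuples, and $\partial(a)\subseteq[n]$ denotes the set of its entries. $d$-stopping set: a set $V'\subseteq[n]$ such that $|\partial(a)\cap V'|\notin\{1,2,\dots,d-1\}$ for every $a\in[m]$. $\varphi_{k,r}(\mu,\lambda,\tau):=\mu\bigl(e^{(k-r+1)\lambda}-1\bigr)\binom{k}{r-1}(1+\tau)^{r-1}-\lambda\tau$. *)

theory Defs
  imports "HOL-Analysis.Analysis" "HOL-Library.FuncSet"
begin

text \<open>Constraint a is given by a k-tuple (list) of pairwise distinct elements of [n] = {1..n}.\<close>
definition tuples :: "nat \<Rightarrow> nat \<Rightarrow> nat list set" where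
  "tuples n k = {xs. length xs = k \<and> distinct xs \<and> set xs \<subseteq> {1..n}}"

text \<open>All possible random bipartite graphs with m constraint vertices 0..m-1
  (each outcome equally likely, since tuples are chosen independently and uniformly).\<close>
definition graphs :: "nat \<Rightarrow> nat \<Rightarrow> nat \<Rightarrow> (nat \<Rightarrow> nat list) set" where
  "graphs n m k = {0..<m} \<rightarrow>\<^sub>E tuples n k"

definition stopping_set :: "nat \<Rightarrow> nat \<Rightarrow> (nat \<Rightarrow> nat list) \<Rightarrow> nat set \<Rightarrow> bool" where
  "stopping_set d m G V \<longleftrightarrow> (\<forall>a<m. card (set (G a) \<inter> V) \<notin> {1..d-1})"

definition graph_prob :: "nat \<Rightarrow> nat \<Rightarrow> nat \<Rightarrow> ((nat \<Rightarrow> nat list) \<Rightarrow> bool) \<Rightarrow> real" where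
  "graph_prob n m k P = real (card {G \<in> graphs n m k. P G}) / real (card (graphs n m k))"

definition phi :: "nat \<Rightarrow> nat \<Rightarrow> real \<Rightarrow> real \<Rightarrow> real \<Rightarrow> real" where
  "phi k r \<mu> l \<tau> = \<mu> * (exp (real (k - r + 1) * l) - 1) * real (k choose (r - 1)) * (1 + \<tau>) ^ (r - 1) - l * \<tau>"

definition mu_c :: "nat \<Rightarrow> nat \<Rightarrow> real" where
  "mu_c k r = (1 / real (k choose r)) * (real r - 2) ^ (r - 2) / (real r * (real r - 1) ^ (r - 1))"

definition num_constraints :: "nat \<Rightarrow> nat \<Rightarrow> (nat \<Rightarrow> nat) \<Rightarrow> real \<Rightarrow> nat" where
  "num_constraints n r u \<mu> = nat \<lfloor>\<mu> * real n ^ (r - 1) / real (u n) ^ (r - 2)\<rfloor>"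

definition p_stop :: "nat \<Rightarrow> nat \<Rightarrow> (nat \<Rightarrow> nat) \<Rightarrow> real \<Rightarrow> real \<Rightarrow> nat \<Rightarrow> real" where
  "p_stop k r u \<mu> \<tau> n = graph_prob n (num_constraints n r u \<mu>) k
     (\<lambda>G. \<exists>V. V \<subseteq> {u n + 1..n} \<and> real (card V) > real n - (1 + \<tau>) * real (u n)
              \<and> stopping_set (k - r + 2) (num_constraints n r u \<mu>) G V)"

end

theory Submission
  imports Defs
begin

text \<open>
  Let \<open>A\<close> be the closure of \<open>{1..u}\<close> under the rule that a constraint with at least \<open>r - 1\<close> entries in
  \<open>A\<close> puts all its entries into \<open>A\<close>; its complement is a \<open>(k - r + 2)\<close>-stopping set. Explore \<open>A\<close> one vertex
  at a time. If the exploration lasts for \<open>T = \<lfloor>(1 + \<tau>')u\<rfloor>\<close> steps, then the constraints with at least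
  \<open>r - 1\<close> entries among the first \<open>T\<close> explored vertices have activated more than \<open>\<tau>'u\<close> vertices, each of
  them at most \<open>k - r + 1\<close>. Although the explored set depends on the graph, the number of these
  constraints has the same law as for the fixed set \<open>{1..T}\<close>: relabel each tuple by a permutation
  sending the explored vertices to their exploration times, frozen at the moment the constraint is
  triggered; this is an injection on graphs. For a fixed set the constraints are independent, and
  Chernoff's bound gives failure probability at most \<open>exp (\<phi>(\<mu>,\<lambda>,\<tau>') u)\<close> for all \<open>\<lambda>\<close> and \<open>\<tau>'\<close>, so
  that the error term of the theorem can be taken to be zero.
\<close>

section \<open>Tuples meeting a fixed set\<close>

lemma ex_bij_betw_extending:
  assumes "finite A" "S \<subseteq> A" "inj_on f S" "f ` S \<subseteq> A"
  shows "\<exists>g. bij_betw g A A \<and> (\<forall>x\<in>S. g x = f x)"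
proof -
  have "card (A - S) = card (A - f ` S)"
    using assms by (simp add: card_Diff_subset card_image finite_subset)
  then obtain h where h: "bij_betw h (A - S) (A - f ` S)"
    using finite_same_card_bij[of "A - S" "A - f ` S"] assms(1) by auto
  define g where "g x = (if x \<in> S then f x else h x)" for x
  have "bij_betw g S (f ` S)"
    using assms(3) by (auto simp: g_def bij_betw_def inj_on_def)
  moreover have "bij_betw g (A - S) (A - f ` S)"
    using h by (rule bij_betw_cong[THEN iffD1, rotated]) (simp add: g_def)
  ultimately have "bij_betw g (S \<union> (A - S)) (f ` S \<union> (A - f ` S))"
    by (rule bij_betw_combine) blast
  moreover have "S \<union> (A - S) = A" "f ` S \<union> (A - f ` S) = A"
    using assms by auto
  ultimately show ?thesis by (intro exI[of _ g]) (simp add: g_def)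
qed

lemma finite_tuples: "finite (tuples n k)"
proof (rule finite_subset)
  show "tuples n k \<subseteq> {xs. set xs \<subseteq> {1..n} \<and> length xs = k}"
    by (auto simp: tuples_def)
qed (simp add: finite_lists_length_eq)

lemma finite_graphs: "finite (graphs n m k)"
  unfolding graphs_def by (intro finite_PiE) (auto simp: finite_tuples)

lemma tuples_nonempty: "k \<le> n \<Longrightarrow> tuples n k \<noteq> {}"
proof -
  assume "k \<le> n"
  then have "[1..<Suc k] \<in> tuples n k" by (auto simp: tuples_def)
  then show ?thesis by blast
qed

lemma card_set_tuple: "xs \<in> tuples n k \<Longrightarrow> card (set xs) = k"
  by (auto simp: tuples_def distinct_card)

lemma map_tuple:
  assumes "bij_betw g {1..n} {1..n}" "xs \<in> tuples n k"
  shows "map g xs \<in> tuples n k"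
  using assms unfolding tuples_def bij_betw_def
  by (auto simp: distinct_map intro: inj_on_subset)

lemma map_tuple_inject:
  assumes "bij_betw g {1..n} {1..n}" "xs \<in> tuples n k" "ys \<in> tuples n k" "map g xs = map g ys"
  shows "xs = ys"
proof -
  have "inj_on g (set xs \<union> set ys)"
    using assms unfolding tuples_def bij_betw_def by (auto intro: inj_on_subset)
  with assms(4) show ?thesis by (rule map_inj_on)
qed

text \<open>A permutation of \<open>{1..n}\<close> carrying \<open>S\<close> onto \<open>S'\<close>
  acts injectively on tuples. Used in both directions it gives equality.\<close>

lemma card_tuples_containing_mono:
  assumes "S \<subseteq> {1..n}" "S' \<subseteq> {1..n}" "card S = card S'"
  shows "card {xs \<in> tuples n k. S \<subseteq> set xs} \<le> card {xs \<in> tuples n k. S' \<subseteq> set xs}"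
proof -
  have "finite S" "finite S'" using assms finite_subset by blast+
  then obtain f where f: "bij_betw f S S'"
    using finite_same_card_bij assms(3) by blast
  obtain g where g: "bij_betw g {1..n} {1..n}" "\<forall>x\<in>S. g x = f x"
    using ex_bij_betw_extending[of "{1..n}" S f] f assms by (auto simp: bij_betw_def)
  have gS: "g ` S = S'"
    using g(2) f by (auto simp: bij_betw_def)
  show ?thesis
  proof (rule card_inj_on_le)
    show "inj_on (map g) {xs \<in> tuples n k. S \<subseteq> set xs}"
      using map_tuple_inject[OF g(1)] by (auto intro!: inj_onI)
    show "map g ` {xs \<in> tuples n k. S \<subseteq> set xs} \<subseteq> {xs \<in> tuples n k. S' \<subseteq> set xs}"
      using map_tuple[OF g(1)] gS by auto
  qed (simp add: finite_tuples)
qed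

text \<open>Double counting of pairs of a tuple and an \<open>s\<close>-subset of
  \<open>{1..T}\<close> among its entries. By symmetry every subset contributes as much as
  \<open>{1..s}\<close>.\<close>

lemma sum_choose_tuples:
  assumes "T \<le> n"
  shows "(\<Sum>xs\<in>tuples n k. card (set xs \<inter> {1..T}) choose s)
    = (T choose s) * card {xs \<in> tuples n k. {1..s} \<subseteq> set xs}"
proof -
  have "(\<Sum>xs\<in>tuples n k. card (set xs \<inter> {1..T}) choose s)
      = (\<Sum>xs\<in>tuples n k. card {S. S \<subseteq> {1..T} \<and> card S = s \<and> S \<subseteq> set xs})"
  proof (rule sum.cong)
    fix xs
    show "card (set xs \<inter> {1..T}) choose s = card {S. S \<subseteq> {1..T} \<and> card S = s \<and> S \<subseteq> set xs}"
      using n_subsets[of "set xs \<inter> {1..T}" s] by (simp add: conj_ac)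
  qed simp
  also have "\<dots> = (\<Sum>xs\<in>tuples n k. \<Sum>S\<in>{S. S \<subseteq> {1..T} \<and> card S = s}. if S \<subseteq> set xs then 1 else 0)"
    by (intro sum.cong refl) (auto simp: sum.If_cases intro!: arg_cong[where f=card])
  also have "\<dots> = (\<Sum>S\<in>{S. S \<subseteq> {1..T} \<and> card S = s}. card {xs \<in> tuples n k. S \<subseteq> set xs})"
    by (subst sum.swap) (auto simp: sum.If_cases finite_tuples intro!: sum.cong arg_cong[where f=card])
  also have "\<dots> = (\<Sum>S\<in>{S. S \<subseteq> {1..T} \<and> card S = s}. card {xs \<in> tuples n k. {1..s} \<subseteq> set xs})"
  proof (rule sum.cong)
    fix S assume "S \<in> {S. S \<subseteq> {1..T} \<and> card S = s}"
    then have S: "S \<subseteq> {1..T}" "card S = s" by auto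
    then have "s \<le> T" using card_mono[of "{1..T}" S] by simp
    then show "card {xs \<in> tuples n k. S \<subseteq> set xs} = card {xs \<in> tuples n k. {1..s} \<subseteq> set xs}"
      using S assms by (intro antisym card_tuples_containing_mono) auto
  qed simp
  also have "\<dots> = (T choose s) * card {xs \<in> tuples n k. {1..s} \<subseteq> set xs}"
    using n_subsets[of "{1..T}" s] by simp
  finally show ?thesis .
qed

text \<open>Each factor \<open>(T - i) / (n - i)\<close> of the quotient of the binomials is at most
  \<open>T / n\<close>; everything is multiplied out to avoid division.\<close>

lemma choose_ratio_le:
  "T \<le> n \<Longrightarrow> real (T choose s) * real n ^ s \<le> real T ^ s * real (n choose s)"
proof (induction s arbitrary: T n)
  case (Suc s)
  show ?case
  proof (cases T)
    case (Suc T')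
    then obtain n' where n: "n = Suc n'" "T' \<le> n'" using Suc.prems by (cases n) auto
    have rec: "real (Suc s) * real (Suc N choose Suc s) = real (Suc N) * real (N choose s)" for N
      using Suc_times_binomial_eq[of N s] by (metis of_nat_mult mult.commute)
    \<comment> \<open>The induction hypothesis yields the ratio \<open>T' / n'\<close>, which is at
      most \<open>T / n\<close>. Cancelling \<open>n' ^ s\<close> requires the case
      \<open>n' = 0\<close> to be separate.\<close>
    have key: "real (T' choose s) * real n ^ s \<le> real T ^ s * real (n' choose s)"
    proof (cases "n' = 0")
      case True
      then show ?thesis using n Suc by simp
    next
      case False
      have "real (T' choose s) * (real n' * real n) ^ s
          = real n ^ s * (real (T' choose s) * real n' ^ s)"
        by (simp add: power_mult_distrib)
      also have "\<dots> \<le> real n ^ s * (real T' ^ s * real (n' choose s))"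
        by (intro mult_left_mono Suc.IH n) simp
      also have "\<dots> = (real T' * real n) ^ s * real (n' choose s)"
        by (simp add: power_mult_distrib)
      also have "\<dots> \<le> (real T * real n') ^ s * real (n' choose s)"
        using n Suc by (intro mult_right_mono power_mono) (auto simp: algebra_simps)
      finally have "real n' ^ s * (real (T' choose s) * real n ^ s)
          \<le> real n' ^ s * (real T ^ s * real (n' choose s))"
        by (simp add: power_mult_distrib mult_ac)
      then show ?thesis using False by (simp add: mult_le_cancel_left)
    qed
    have "real (Suc s) * (real (T choose Suc s) * real n ^ Suc s)
        = real T * real n * (real (T' choose s) * real n ^ s)"
      using rec[of T'] Suc by (simp add: mult_ac del: of_nat_Suc binomial_Suc_Suc)
    also have "\<dots> \<le> real T * real n * (real T ^ s * real (n' choose s))"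
      by (intro mult_left_mono key) simp
    also have "\<dots> = real (Suc s) * (real T ^ Suc s * real (n choose Suc s))"
      using rec[of n'] n by (simp add: mult_ac del: of_nat_Suc binomial_Suc_Suc)
    finally show ?thesis by (simp add: mult_le_cancel_left del: of_nat_Suc)
  qed simp
qed simp

text \<open>A union bound over \<open>s\<close>-subsets of \<open>{1..T}\<close>: a tuple with at
  least \<open>s\<close> hits is counted at least once by the binomial coefficient.\<close>

lemma card_tuples_hitting_le:
  assumes "T \<le> n" "0 < n" "s \<le> n"
  shows "real (card {xs \<in> tuples n k. s \<le> card (set xs \<inter> {1..T})})
    \<le> real (card (tuples n k)) * (real (k choose s) * (real T / real n) ^ s)"
proof -
  define M where "M = card {xs \<in> tuples n k. {1..s} \<subseteq> set xs}"
  have "card {xs \<in> tuples n k. s \<le> card (set xs \<inter> {1..T})}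
      = (\<Sum>xs\<in>{xs \<in> tuples n k. s \<le> card (set xs \<inter> {1..T})}. 1)" by simp
  also have "\<dots> \<le> (\<Sum>xs\<in>{xs \<in> tuples n k. s \<le> card (set xs \<inter> {1..T})}. card (set xs \<inter> {1..T}) choose s)"
    by (intro sum_mono) (simp add: Suc_le_eq)
  also have "\<dots> \<le> (\<Sum>xs\<in>tuples n k. card (set xs \<inter> {1..T}) choose s)"
    by (intro sum_mono2) (auto simp: finite_tuples)
  also have "\<dots> = (T choose s) * M"
    unfolding M_def by (rule sum_choose_tuples[OF assms(1)])
  finally have 1: "card {xs \<in> tuples n k. s \<le> card (set xs \<inter> {1..T})} \<le> (T choose s) * M" .
  \<comment> \<open>The same double count with \<open>T = n\<close> determines \<open>M\<close>, so
    no falling factorials have to be computed.\<close>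
  have "(\<Sum>xs\<in>tuples n k. card (set xs \<inter> {1..n}) choose s) = (\<Sum>xs\<in>tuples n k. k choose s)"
  proof (rule sum.cong)
    fix xs assume "xs \<in> tuples n k"
    then have "set xs \<inter> {1..n} = set xs" "card (set xs) = k"
      by (auto simp: tuples_def distinct_card)
    then show "card (set xs \<inter> {1..n}) choose s = k choose s" by simp
  qed simp
  then have 2: "(n choose s) * M = card (tuples n k) * (k choose s)"
    using sum_choose_tuples[where T = n and n = n and k = k and s = s] unfolding M_def by simp
  have "real (card {xs \<in> tuples n k. s \<le> card (set xs \<inter> {1..T})}) \<le> real (T choose s) * real M"
    using 1 by (metis of_nat_le_iff of_nat_mult)
  also have "\<dots> \<le> (real T / real n) ^ s * real (n choose s) * real M"
    using choose_ratio_le[OF assms(1), of s] assms(2)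
    by (intro mult_right_mono) (simp_all add: power_divide field_simps)
  also have "\<dots> = real (card (tuples n k)) * (real (k choose s) * (real T / real n) ^ s)"
    using arg_cong[OF 2, of real] by (simp add: mult_ac)
  finally show ?thesis .
qed

section \<open>Exploration\<close>

text \<open>Here \<open>s\<close> stands for \<open>r - 1\<close>, the number of explored entries
  that triggers a constraint. Positivity of \<open>s\<close> ensures that nothing is triggered
  before the first step.\<close>

locale exploration =
  fixes n k m u s T :: nat
  assumes T_le: "T \<le> n" and u_le: "u \<le> n" and s_pos: "0 < s"
begin

definition triggered :: "(nat \<Rightarrow> nat list) \<Rightarrow> nat set \<Rightarrow> nat set" where
  "triggered G E = {a. a < m \<and> s \<le> card (set (G a) \<inter> E)}"

definition active :: "(nat \<Rightarrow> nat list) \<Rightarrow> nat set \<Rightarrow> nat set" where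
  "active G E = {1..u} \<union> (\<Union>a\<in>triggered G E. set (G a))"

text \<open>Once every active vertex is explored, the exploration continues with arbitrary vertices,
  so that it always lasts for \<open>n\<close> steps.\<close>
definition next_vertex :: "(nat \<Rightarrow> nat list) \<Rightarrow> nat set \<Rightarrow> nat" where
  "next_vertex G E = (SOME v. v \<in> (if active G E \<subseteq> E then {1..n} else active G E) - E)"

primrec explored :: "(nat \<Rightarrow> nat list) \<Rightarrow> nat \<Rightarrow> nat set" where
  "explored G 0 = {}"
| "explored G (Suc t) = insert (next_vertex G (explored G t)) (explored G t)"

definition vertex :: "(nat \<Rightarrow> nat list) \<Rightarrow> nat \<Rightarrow> nat" where
  "vertex G t = next_vertex G (explored G t)"

lemma finite_triggered: "finite (triggered G E)"
  by (simp add: triggered_def)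

lemma triggered_mono: "E \<subseteq> E' \<Longrightarrow> triggered G E \<subseteq> triggered G E'"
proof
  fix a assume "E \<subseteq> E'" "a \<in> triggered G E"
  moreover from this have "card (set (G a) \<inter> E) \<le> card (set (G a) \<inter> E')"
    by (intro card_mono) auto
  ultimately show "a \<in> triggered G E'" by (simp add: triggered_def)
qed

lemma active_mono: "E \<subseteq> E' \<Longrightarrow> active G E \<subseteq> active G E'"
  using triggered_mono[of E E' G] by (auto simp: active_def)

lemma graph_tuple: "G \<in> graphs n m k \<Longrightarrow> a < m \<Longrightarrow> G a \<in> tuples n k"
  by (auto simp: graphs_def)

lemma active_subset: "G \<in> graphs n m k \<Longrightarrow> active G E \<subseteq> {1..n}"
  using u_le graph_tuple[of G] by (auto simp: active_def triggered_def tuples_def)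

lemma explored_eq: "explored G t = vertex G ` {..<t}"
  by (induction t) (simp_all add: vertex_def lessThan_Suc)

lemma next_vertex_in:
  assumes "G \<in> graphs n m k" "E \<subseteq> {1..n}" "E \<noteq> {1..n}"
  shows "next_vertex G E \<in> {1..n} - E" and
    "\<not> active G E \<subseteq> E \<Longrightarrow> next_vertex G E \<in> active G E"
proof -
  let ?W = "(if active G E \<subseteq> E then {1..n} else active G E) - E"
  have "\<exists>v. v \<in> ?W" using assms by auto
  from someI_ex[OF this] have *: "next_vertex G E \<in> ?W"
    unfolding next_vertex_def .
  then show "next_vertex G E \<in> {1..n} - E"
    using active_subset[OF assms(1), of E] by (auto split: if_splits)
  show "next_vertex G E \<in> active G E" if "\<not> active G E \<subseteq> E"
    using * that by auto
qed

lemma explored_subset_card: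
  assumes "G \<in> graphs n m k"
  shows "t \<le> n \<Longrightarrow> explored G t \<subseteq> {1..n} \<and> card (explored G t) = t"
proof (induction t)
  case (Suc t)
  then have IH: "explored G t \<subseteq> {1..n}" "card (explored G t) = t" by auto
  then have "explored G t \<noteq> {1..n}" using Suc.prems by auto
  with IH next_vertex_in(1)[OF assms IH(1)] show ?case
    using finite_subset[OF IH(1)] by auto
qed simp

lemma finite_explored: "finite (explored G t)"
  by (simp add: explored_eq)

lemma inj_on_vertex:
  assumes "G \<in> graphs n m k" "t \<le> n"
  shows "inj_on (vertex G) {..<t}"
  using explored_subset_card[OF assms] by (intro eq_card_imp_inj_on) (auto simp: explored_eq)

section \<open>Relabelling the tuples by exploration time\<close>

text \<open>The chosen permutation is determined by the first \<open>t\<close> explored vertices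
  alone, which makes it recoverable later. The shift to \<open>Suc i\<close> matches vertices
  numbered from 1.\<close>

definition relabel :: "(nat \<Rightarrow> nat list) \<Rightarrow> nat \<Rightarrow> nat \<Rightarrow> nat" where
  "relabel G t = (SOME g. bij_betw g {1..n} {1..n} \<and> (\<forall>i<t. g (vertex G i) = Suc i))"

text \<open>The cap at \<open>T\<close> makes the minimum exist and gives constraints that are never
  triggered the permutation of the full exploration.\<close>

definition trigger_time :: "(nat \<Rightarrow> nat list) \<Rightarrow> nat \<Rightarrow> nat" where
  "trigger_time G a = (LEAST t. t \<ge> T \<or> s \<le> card (set (G a) \<inter> explored G t))"

definition relabelled :: "(nat \<Rightarrow> nat list) \<Rightarrow> nat \<Rightarrow> nat list" where
  "relabelled G = (\<lambda>a\<in>{0..<m}. map (relabel G (trigger_time G a)) (G a))"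

lemma relabel:
  assumes G: "G \<in> graphs n m k" and t: "t \<le> n"
  shows "bij_betw (relabel G t) {1..n} {1..n}" "i < t \<Longrightarrow> relabel G t (vertex G i) = Suc i"
proof -
  define f where "f = (\<lambda>x. Suc (the_inv_into {..<t} (vertex G) x))"
  note inj = inj_on_vertex[OF assms]
  have f: "f (vertex G i) = Suc i" if "i < t" for i
    using that by (simp add: f_def the_inv_into_f_f[OF inj])
  have "\<exists>g. bij_betw g {1..n} {1..n} \<and> (\<forall>x\<in>explored G t. g x = f x)"
  proof (rule ex_bij_betw_extending)
    show "explored G t \<subseteq> {1..n}" using explored_subset_card[OF assms] by simp
    show "inj_on f (explored G t)"
      by (rule inj_onI) (auto simp: explored_eq f)
    show "f ` explored G t \<subseteq> {1..n}"
      using t by (auto simp: explored_eq f)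
  qed simp
  then have "\<exists>g. bij_betw g {1..n} {1..n} \<and> (\<forall>i<t. g (vertex G i) = Suc i)"
    using f by (auto simp: explored_eq)
  from someI_ex[OF this] show "bij_betw (relabel G t) {1..n} {1..n}"
    "i < t \<Longrightarrow> relabel G t (vertex G i) = Suc i"
    unfolding relabel_def by auto
qed

lemma relabel_explored:
  assumes "G \<in> graphs n m k" "t \<le> n" "j \<le> t"
  shows "relabel G t ` explored G j = {1..j}"
proof -
  have "relabel G t ` explored G j = Suc ` {..<j}"
    using relabel(2)[OF assms(1,2)] assms(3)
    by (auto simp: explored_eq image_image intro!: image_cong)
  then show ?thesis by (simp add: image_Suc_lessThan)
qed

lemma relabel_cong:
  "(\<And>i. i < t \<Longrightarrow> vertex G i = vertex G' i) \<Longrightarrow> relabel G t = relabel G' t"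
  unfolding relabel_def by (intro arg_cong[where f = Eps] ext) auto

lemma trigger_time_le: "trigger_time G a \<le> T"
  unfolding trigger_time_def by (rule Least_le) simp

lemma trigger_time_le_n: "trigger_time G a \<le> n"
  using trigger_time_le T_le by (rule order.trans)

lemma relabelled_in_graphs: "G \<in> graphs n m k \<Longrightarrow> relabelled G \<in> graphs n m k"
  using map_tuple[OF relabel(1)] trigger_time_le_n graph_tuple
  by (subst graphs_def) (auto simp: relabelled_def)

lemma card_relabelled_Int:
  assumes G: "G \<in> graphs n m k" and a: "a < m" and j: "j \<le> trigger_time G a"
  shows "card (set (relabelled G a) \<inter> {1..j}) = card (set (G a) \<inter> explored G j)"
proof -
  let ?g = "relabel G (trigger_time G a)"
  note g = relabel(1)[OF G trigger_time_le_n[of G a]]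
  have sub: "set (G a) \<subseteq> {1..n}" "explored G j \<subseteq> {1..n}"
    using graph_tuple[OF G a] explored_subset_card[OF G] j trigger_time_le_n[of G a]
    by (auto simp: tuples_def)
  have inj: "inj_on ?g {1..n}" using g by (simp add: bij_betw_def)
  have "set (relabelled G a) \<inter> {1..j} = ?g ` set (G a) \<inter> ?g ` explored G j"
    using a relabel_explored[OF G trigger_time_le_n j] by (simp add: relabelled_def)
  also have "\<dots> = ?g ` (set (G a) \<inter> explored G j)"
    using inj_on_image_Int[OF inj sub] by simp
  also have "card \<dots> = card (set (G a) \<inter> explored G j)"
    using inj sub by (intro card_image) (auto intro: inj_on_subset)
  finally show ?thesis .
qed

text \<open>Up to the trigger time the permutation carries the explored set onto
  \<open>{1..j}\<close>, so the counts agree. Afterwards they may differ, but both have already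
  reached \<open>s\<close> and cannot decrease.\<close>

lemma triggered_relabelled:
  assumes G: "G \<in> graphs n m k" and a: "a < m" and j: "j \<le> T"
  shows "s \<le> card (set (relabelled G a) \<inter> {1..j}) \<longleftrightarrow> s \<le> card (set (G a) \<inter> explored G j)"
proof (cases "j \<le> trigger_time G a")
  case True
  then show ?thesis using card_relabelled_Int[OF G a] by simp
next
  case False
  let ?t = "trigger_time G a"
  have "?t \<ge> T \<or> s \<le> card (set (G a) \<inter> explored G ?t)"
    unfolding trigger_time_def by (rule LeastI[of _ T]) simp
  then have 1: "s \<le> card (set (G a) \<inter> explored G ?t)" using False j by auto
  then have 2: "s \<le> card (set (relabelled G a) \<inter> {1..?t})"
    using card_relabelled_Int[OF G a order.refl] by simp
  have "card (set (G a) \<inter> explored G ?t) \<le> card (set (G a) \<inter> explored G j)"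
    using False by (intro card_mono) (auto simp: explored_eq)
  moreover have "card (set (relabelled G a) \<inter> {1..?t}) \<le> card (set (relabelled G a) \<inter> {1..j})"
    using False by (intro card_mono) auto
  ultimately show ?thesis using 1 2 by linarith
qed

text \<open>The trigger time can be read off the relabelled graph, so that it is known which
  permutation has to be undone.\<close>

lemma trigger_time_relabelled:
  assumes "G \<in> graphs n m k" "a < m"
  shows "trigger_time G a = (LEAST t. t \<ge> T \<or> s \<le> card (set (relabelled G a) \<inter> {1..t}))"
proof -
  have "(\<lambda>t. t \<ge> T \<or> s \<le> card (set (G a) \<inter> explored G t))
      = (\<lambda>t. t \<ge> T \<or> s \<le> card (set (relabelled G a) \<inter> {1..t}))"
    using triggered_relabelled[OF assms] by (metis nat_le_linear)
  then show ?thesis unfolding trigger_time_def by simp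
qed

text \<open>The exploration order is recovered step by step: the next vertex depends only on the
  explored vertices and the tuples already triggered, and these tuples were relabelled by a
  permutation that depends only on the vertices explored before.\<close>

lemma inj_on_relabelled: "inj_on relabelled (graphs n m k)"
proof (rule inj_onI)
  fix G G' assume G: "G \<in> graphs n m k" and G': "G' \<in> graphs n m k"
    and eq: "relabelled G = relabelled G'"
  have time: "trigger_time G a = trigger_time G' a" if "a < m" for a
    using trigger_time_relabelled[OF G that] trigger_time_relabelled[OF G' that] eq by simp
  have recover: "G a = G' a"
    if a: "a < m" and v: "\<And>i. i < trigger_time G a \<Longrightarrow> vertex G i = vertex G' i" for a
  proof (rule map_tuple_inject)
    show "bij_betw (relabel G (trigger_time G a)) {1..n} {1..n}"
      by (rule relabel(1)[OF G trigger_time_le_n])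
    have "relabel G (trigger_time G a) = relabel G' (trigger_time G' a)"
      using relabel_cong[OF v] time[OF a] by simp
    with a show "map (relabel G (trigger_time G a)) (G a) = map (relabel G (trigger_time G a)) (G' a)"
      using fun_cong[OF eq, of a] by (simp add: relabelled_def)
  qed (use graph_tuple G G' a in auto)
  have vertices: "t \<le> T \<Longrightarrow> \<forall>i<t. vertex G i = vertex G' i" for t
  proof (induction t)
    case (Suc t)
    then have IH: "\<forall>i<t. vertex G i = vertex G' i" by simp
    then have E: "explored G t = explored G' t" by (auto simp: explored_eq)
    have trig: "triggered G (explored G t) = triggered G' (explored G' t)"
      using triggered_relabelled[OF G] triggered_relabelled[OF G'] eq Suc.prems
      by (auto simp: triggered_def)
    have "G a = G' a" if "a \<in> triggered G (explored G t)" for a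
    proof (rule recover)
      show "a < m" using that by (simp add: triggered_def)
      have "trigger_time G a \<le> t"
        unfolding trigger_time_def using that by (intro Least_le) (simp add: triggered_def)
      then show "vertex G i = vertex G' i" if "i < trigger_time G a" for i
        using IH that by simp
    qed
    then have "active G (explored G t) = active G' (explored G' t)"
      using trig by (auto simp: active_def)
    then have "vertex G t = vertex G' t"
      using E by (simp add: vertex_def next_vertex_def)
    then show ?case using IH by (simp add: less_Suc_eq)
  qed simp
  show "G = G'"
  proof
    fix a show "G a = G' a"
    proof (cases "a < m")
      case True
      \<comment> \<open>All trigger times are at most \<open>T\<close>, so the first
        \<open>T\<close> vertices determine every permutation, including those of untriggered
        constraints.\<close>
      show ?thesis
        using vertices[OF trigger_time_le] by (intro recover[OF True]) auto
    next
      case False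
      then have "a \<notin> {0..<m}" by simp
      then show ?thesis
        using PiE_arb[of G "{0..<m}" _ a] PiE_arb[of G' "{0..<m}" _ a] G G'
        unfolding graphs_def by metis
    qed
  qed
qed

text \<open>The injection \<open>relabelled\<close> preserves the number of triggered constraints
  while replacing the random explored set by the fixed set \<open>{1..T}\<close>.\<close>

lemma card_triggered_le:
  "card {G \<in> graphs n m k. P (card (triggered G (explored G T)))}
    \<le> card {G \<in> graphs n m k. P (card (triggered G {1..T}))}"
proof (rule card_inj_on_le)
  show "inj_on relabelled {G \<in> graphs n m k. P (card (triggered G (explored G T)))}"
    using inj_on_relabelled by (rule inj_on_subset) auto
  have "triggered (relabelled G) {1..T} = triggered G (explored G T)" if "G \<in> graphs n m k" for G
    using triggered_relabelled[OF that _ order.refl] by (auto simp: triggered_def)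
  then show "relabelled ` {G \<in> graphs n m k. P (card (triggered G (explored G T)))}
      \<subseteq> {G \<in> graphs n m k. P (card (triggered G {1..T}))}"
    using relabelled_in_graphs by auto
qed (simp add: finite_graphs)

section \<open>Stopping sets and long explorations\<close>

text \<open>A triggered constraint has all its entries explored; any other has at most
  \<open>s - 1\<close> explored entries, hence at least \<open>k - s + 1\<close> unexplored
  ones.\<close>

lemma stopping_set_unexplored:
  assumes G: "G \<in> graphs n m k" and "active G (explored G t) \<subseteq> explored G t" and "s \<le> k"
  shows "stopping_set (k - s + 1) m G ({1..n} - explored G t)"
  unfolding stopping_set_def
proof (intro allI impI)
  fix a assume a: "a < m"
  let ?E = "explored G t"
  have sub: "set (G a) \<subseteq> {1..n}" and card: "card (set (G a)) = k"
    using graph_tuple[OF G a] by (auto simp: tuples_def distinct_card)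
  show "card (set (G a) \<inter> ({1..n} - ?E)) \<notin> {1..k - s + 1 - 1}"
  proof (cases "a \<in> triggered G ?E")
    case True
    then have "set (G a) \<inter> ({1..n} - ?E) = {}"
      using assms(2) by (auto simp: active_def)
    then show ?thesis by simp
  next
    case False
    then have "card (set (G a) \<inter> ?E) < s" using a by (simp add: triggered_def)
    moreover have "set (G a) \<inter> ({1..n} - ?E) = set (G a) - set (G a) \<inter> ?E" using sub by auto
    then have "card (set (G a) \<inter> ({1..n} - ?E)) = k - card (set (G a) \<inter> ?E)"
      using card by (simp add: card_Diff_subset)
    ultimately show ?thesis using \<open>s \<le> k\<close> by auto
  qed
qed

text \<open>While the exploration runs, explored vertices are active already. A newly triggered
  constraint has at least \<open>s\<close> explored entries, so it activates at most
  \<open>k - s\<close> new vertices.\<close>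

lemma card_triggered_ge:
  assumes G: "G \<in> graphs n m k"
    and run: "\<And>t. t \<le> T \<Longrightarrow> \<not> active G (explored G t) \<subseteq> explored G t"
  shows "T < u + (k - s) * card (triggered G (explored G T))"
proof -
  have vertex_active: "vertex G t \<in> active G (explored G t)" if "t < T" for t
  proof -
    have "explored G t \<subseteq> {1..n}" "card (explored G t) = t"
      using explored_subset_card[OF G, of t] that T_le by auto
    moreover from this have "explored G t \<noteq> {1..n}" using that T_le by auto
    ultimately show ?thesis
      using next_vertex_in(2)[OF G] run[of t] that by (auto simp: vertex_def)
  qed
  have main: "t \<le> T \<Longrightarrow> explored G t \<subseteq> active G (explored G t) \<and>
      card (active G (explored G t)) \<le> u + (k - s) * card (triggered G (explored G t))" for t
  proof (induction t)
    case 0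
    have "triggered G {} = {}" using s_pos by (auto simp: triggered_def)
    then show ?case by (simp add: active_def)
  next
    case (Suc t)
    let ?E = "explored G t" and ?E' = "explored G (Suc t)"
    let ?new = "triggered G ?E' - triggered G ?E"
    have mono: "?E \<subseteq> ?E'" by auto
    have sub: "?E' \<subseteq> active G ?E"
      using Suc vertex_active[of t] by (auto simp: vertex_def)
    have "active G ?E' \<subseteq> active G ?E \<union> (\<Union>a\<in>?new. set (G a) - ?E')"
      using sub by (auto simp: active_def)
    then have "card (active G ?E') \<le> card (active G ?E \<union> (\<Union>a\<in>?new. set (G a) - ?E'))"
      by (intro card_mono) (auto simp: finite_triggered active_def)
    also have "\<dots> \<le> card (active G ?E) + card (\<Union>a\<in>?new. set (G a) - ?E')"
      by (rule card_Un_le)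
    also have "card (\<Union>a\<in>?new. set (G a) - ?E') \<le> (\<Sum>a\<in>?new. card (set (G a) - ?E'))"
      by (intro card_UN_le) (simp add: finite_triggered)
    also have "\<dots> \<le> (\<Sum>a\<in>?new. k - s)"
    proof (rule sum_mono)
      fix a assume "a \<in> ?new"
      then have a: "a < m" "s \<le> card (set (G a) \<inter> ?E')" by (auto simp: triggered_def)
      have "card (set (G a) - ?E') = k - card (set (G a) \<inter> ?E')"
        using card_Diff_subset_Int[of "set (G a)" ?E'] card_set_tuple[OF graph_tuple[OF G a(1)]]
        by simp
      then show "card (set (G a) - ?E') \<le> k - s" using a(2) by simp
    qed
    also have "\<dots> = (k - s) * card ?new" by simp
    also have "card (active G ?E) \<le> u + (k - s) * card (triggered G ?E)"
      using Suc by simp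
    finally have "card (active G ?E') \<le> u + (k - s) * (card (triggered G ?E) + card ?new)"
      by (simp add: algebra_simps)
    moreover have "card (triggered G ?E) + card ?new = card (triggered G ?E')"
      using triggered_mono[OF mono, of G] finite_triggered[of G ?E']
      by (metis add.commute card_Diff_subset card_mono finite_subset le_add_diff_inverse2)
    ultimately show ?case
      using sub active_mono[OF mono, of G] by (auto simp del: explored.simps)
  qed
  \<comment> \<open>The run has not stopped at time \<open>T\<close> itself, so some active vertex
    is still unexplored. This strictness produces the \<open>T + 1\<close> in the Chernoff
    exponent.\<close>
  have "explored G T \<subset> active G (explored G T)"
    using main[of T] run[of T] by auto
  then have "card (explored G T) < card (active G (explored G T))"
    using finite_subset[OF active_subset[OF G]] by (intro psubset_card_mono) auto
  then show ?thesis
    using main[of T] explored_subset_card[OF G T_le] by simp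
qed

section \<open>Exponential moments\<close>

text \<open>For a fixed set the constraints are independent: the weight is a product over
  constraints, and its sum over the product space factorizes.\<close>

lemma sum_exp_triggered:
  "(\<Sum>G\<in>graphs n m k. exp (c * real (card (triggered G {1..T}))))
    = (real (card (tuples n k))
        + (exp c - 1) * real (card {xs \<in> tuples n k. s \<le> card (set xs \<inter> {1..T})})) ^ m"
proof -
  define w where "w xs = (if s \<le> card (set xs \<inter> {1..T}) then exp c else 1)" for xs :: "nat list"
  let ?H = "{xs \<in> tuples n k. s \<le> card (set xs \<inter> {1..T})}"
  have "exp (c * real (card (triggered G {1..T}))) = (\<Prod>a\<in>{0..<m}. w (G a))" for G
  proof -
    have "triggered G {1..T} = {0..<m} \<inter> {a. s \<le> card (set (G a) \<inter> {1..T})}"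
      by (auto simp: triggered_def)
    then have "(\<Prod>a\<in>{0..<m}. w (G a)) = exp c ^ card (triggered G {1..T})"
      unfolding w_def by (simp add: prod.If_cases)
    then show ?thesis by (simp add: exp_of_nat2_mult)
  qed
  then have "(\<Sum>G\<in>graphs n m k. exp (c * real (card (triggered G {1..T}))))
      = (\<Sum>xs\<in>tuples n k. w xs) ^ m"
    unfolding graphs_def
    using prod_sum_PiE[of "{0..<m}" "\<lambda>_. tuples n k" "\<lambda>_. w"] by (simp add: finite_tuples)
  also have "(\<Sum>xs\<in>tuples n k. w xs) = (\<Sum>xs\<in>tuples n k. 1 + (if s \<le> card (set xs \<inter> {1..T}) then exp c - 1 else 0))"
    by (intro sum.cong) (auto simp: w_def)
  also have "\<dots> = real (card (tuples n k)) + (exp c - 1) * real (card ?H)"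
    by (simp add: sum.distrib sum.If_cases finite_tuples Int_def mult.commute)
  finally show ?thesis .
qed

text \<open>Chernoff's bound: the event is transferred to \<open>{1..T}\<close>, its indicator is
  dominated by an exponential, and each factor of the moment is bounded by
  \<open>1 + x \<le> exp x\<close>.\<close>

lemma card_unstoppable_le:
  assumes "s \<le> k" "k \<le> n" "0 < n" "0 < l"
  shows "real (card {G \<in> graphs n m k. \<forall>t\<le>T. \<not> active G (explored G t) \<subseteq> explored G t})
    \<le> real (card (graphs n m k)) * exp (real m * ((exp (real (k - s) * l) - 1)
          * (real (k choose s) * (real T / real n) ^ s)) - l * (real T + 1 - real u))"
proof -
  define N where "N = real (card (tuples n k))"
  define q where "q = real (k choose s) * (real T / real n) ^ s"
  \<comment> \<open>The factor \<open>k - s\<close> turns a count of constraints into a bound on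
    activated vertices, so \<open>l\<close> is the exponential parameter per vertex.\<close>
  define c where "c = real (k - s) * l"
  define P where "P x \<longleftrightarrow> T < u + (k - s) * x" for x
  have c: "exp c \<ge> 1" using assms by (simp add: c_def)
  have q: "0 \<le> q" by (simp add: q_def)
  have gr: "real (card (graphs n m k)) = N ^ m"
    by (simp add: graphs_def card_PiE N_def)
  have "card {G \<in> graphs n m k. \<forall>t\<le>T. \<not> active G (explored G t) \<subseteq> explored G t}
      \<le> card {G \<in> graphs n m k. P (card (triggered G (explored G T)))}"
    using card_triggered_ge by (intro card_mono) (auto simp: finite_graphs P_def)
  also have "\<dots> \<le> card {G \<in> graphs n m k. P (card (triggered G {1..T}))}"
    by (rule card_triggered_le)
  finally have "real (card {G \<in> graphs n m k. \<forall>t\<le>T. \<not> active G (explored G t) \<subseteq> explored G t})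
      \<le> real (card {G \<in> graphs n m k. P (card (triggered G {1..T}))})" by simp
  also have "\<dots> = (\<Sum>G\<in>{G \<in> graphs n m k. P (card (triggered G {1..T}))}. 1)" by simp
  also have "\<dots> \<le> (\<Sum>G\<in>{G \<in> graphs n m k. P (card (triggered G {1..T}))}.
      exp (c * real (card (triggered G {1..T})) - l * (real T + 1 - real u)))"
  proof (rule sum_mono)
    fix G assume "G \<in> {G \<in> graphs n m k. P (card (triggered G {1..T}))}"
    then have "real T + 1 - real u \<le> real (k - s) * real (card (triggered G {1..T}))"
      unfolding P_def by (simp flip: of_nat_mult)
    then have "l * (real T + 1 - real u) \<le> l * (real (k - s) * real (card (triggered G {1..T})))"
      using assms by (intro mult_left_mono) auto
    then show "1 \<le> exp (c * real (card (triggered G {1..T})) - l * (real T + 1 - real u))"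
      by (simp add: c_def mult_ac)
  qed
  also have "\<dots> \<le> (\<Sum>G\<in>graphs n m k. exp (c * real (card (triggered G {1..T})) - l * (real T + 1 - real u)))"
    by (intro sum_mono2) (auto simp: finite_graphs)
  also have "\<dots> = (\<Sum>G\<in>graphs n m k. exp (c * real (card (triggered G {1..T})))) * exp (- (l * (real T + 1 - real u)))"
    by (simp add: sum_distrib_right exp_diff exp_minus divide_inverse)
  also have "\<dots> \<le> (N ^ m * exp (real m * ((exp c - 1) * q))) * exp (- (l * (real T + 1 - real u)))"
  proof (intro mult_right_mono)
    have "N + (exp c - 1) * real (card {xs \<in> tuples n k. s \<le> card (set xs \<inter> {1..T})})
        \<le> N + (exp c - 1) * (N * q)"
      using card_tuples_hitting_le[OF T_le \<open>0 < n\<close>, of s k] assms c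
      by (intro add_left_mono mult_left_mono) (auto simp: N_def q_def)
    also have "\<dots> = N * (1 + (exp c - 1) * q)" by (simp add: algebra_simps)
    also have "\<dots> \<le> N * exp ((exp c - 1) * q)"
      by (intro mult_left_mono exp_ge_add_one_self) (simp add: N_def)
    finally have "(N + (exp c - 1) * real (card {xs \<in> tuples n k. s \<le> card (set xs \<inter> {1..T})})) ^ m
        \<le> (N * exp ((exp c - 1) * q)) ^ m"
      using c by (intro power_mono) (auto simp: N_def)
    also have "\<dots> = N ^ m * exp (real m * ((exp c - 1) * q))"
      by (simp add: power_mult_distrib exp_of_nat_mult)
    finally show "(\<Sum>G\<in>graphs n m k. exp (c * real (card (triggered G {1..T})))) \<le> \<dots>"
      unfolding sum_exp_triggered N_def .
  qed simp
  also have "\<dots> = N ^ m * exp (real m * ((exp c - 1) * q) - l * (real T + 1 - real u))"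
    by (simp add: exp_diff exp_minus divide_inverse)
  finally show ?thesis by (simp add: gr c_def q_def)
qed

end

section \<open>The failure probability\<close>

lemma p_stop_ge:
  fixes k r n :: nat and u :: "nat \<Rightarrow> nat" and \<mu> \<tau> \<tau>' l :: real
  assumes r: "3 \<le> r" "r \<le> k" and n: "k \<le> n" "0 < u n" "(1 + \<tau>) * real (u n) \<le> real n"
    and \<mu>: "0 < \<mu>" and l: "0 < l" and \<tau>': "0 < \<tau>'" "\<tau>' < \<tau>"
  shows "1 - exp (phi k r \<mu> l \<tau>' * real (u n)) \<le> p_stop k r u \<mu> \<tau> n"
proof -
  define U where "U = real (u n)"
  define s where "s = r - 1"
  define m where "m = num_constraints n r u \<mu>"
  \<comment> \<open>Both roundings are favourable: hitting probabilities use
    \<open>T \<le> (1 + \<tau>') * U\<close>, the threshold uses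
    \<open>T + 1 > (1 + \<tau>') * U\<close>. Hence no error term arises.\<close>
  define T where "T = nat \<lfloor>(1 + \<tau>') * U\<rfloor>"
  define Q where "Q = (\<lambda>G. \<exists>V. V \<subseteq> {u n + 1..n} \<and> real (card V) > real n - (1 + \<tau>) * real (u n)
              \<and> stopping_set (k - r + 2) m G V)"
  have U: "0 < U" using n by (simp add: U_def)
  have n0: "0 < n" using r n by simp
  have T_ub: "real T \<le> (1 + \<tau>') * U" and T_lb: "(1 + \<tau>') * U < real T + 1"
    using U \<tau>' by (auto simp: T_def)
  have lt: "(1 + \<tau>') * U < (1 + \<tau>) * U" using U \<tau>' by simp
  have T_n: "T \<le> n" using T_ub lt n(3) by (simp add: U_def)
  have u_n: "u n \<le> n"
  proof -
    have "1 * U \<le> (1 + \<tau>) * U" using U \<tau>' by (intro mult_right_mono) auto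
    then show ?thesis using n(3) by (simp add: U_def)
  qed
  interpret exploration n k m "u n" s T
    using T_n u_n r by unfold_locales (auto simp: s_def)
  let ?bad = "{G \<in> graphs n m k. \<forall>t\<le>T. \<not> active G (explored G t) \<subseteq> explored G t}"
  have good: "Q G" if G: "G \<in> graphs n m k" "G \<notin> ?bad" for G
  proof -
    obtain t where t: "t \<le> T" "active G (explored G t) \<subseteq> explored G t" using G by auto
    let ?V = "{1..n} - explored G t"
    have "k - s + 1 = k - r + 2" "s \<le> k" using r by (auto simp: s_def)
    then have "stopping_set (k - r + 2) m G ?V"
      using stopping_set_unexplored[OF G(1) t(2)] by simp
    moreover have "?V \<subseteq> {u n + 1..n}"
    proof -
      have "{1..u n} \<subseteq> explored G t" using t(2) by (auto simp: active_def)
      then show ?thesis by force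
    qed
    moreover have "explored G t \<subseteq> {1..n}" "card (explored G t) = t"
      using explored_subset_card[OF G(1), of t] t(1) T_n by auto
    then have "card ?V = n - t" by (simp add: card_Diff_subset finite_explored)
    then have "real (card ?V) > real n - (1 + \<tau>) * real (u n)"
      using t(1) T_n T_ub lt by (simp add: of_nat_diff U_def)
    ultimately show ?thesis unfolding Q_def by blast
  qed
  have split: "card (graphs n m k) \<le> card {G \<in> graphs n m k. Q G} + card ?bad"
  proof -
    have "card (graphs n m k) \<le> card ({G \<in> graphs n m k. Q G} \<union> ?bad)"
      using good by (intro card_mono) (auto simp: finite_graphs)
    also have "\<dots> \<le> card {G \<in> graphs n m k. Q G} + card ?bad" by (rule card_Un_le)
    finally show ?thesis .
  qed
  have pos: "0 < card (graphs n m k)"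
    using tuples_nonempty[OF n(1)] finite_tuples[of n k]
    by (simp add: graphs_def card_PiE card_gt_0_iff)
  have m: "real m \<le> \<mu> * real n ^ s / U ^ (r - 2)"
    using \<mu> U by (auto simp: m_def num_constraints_def s_def U_def)
  have exponent: "real m * ((exp (real (k - s) * l) - 1) * (real (k choose s) * (real T / real n) ^ s))
      - l * (real T + 1 - real (u n)) \<le> phi k r \<mu> l \<tau>' * U"
  proof -
    define A where "A = exp (real (k - s) * l) - 1"
    have A: "0 \<le> A" using l by (simp add: A_def)
    have "real m * (A * (real (k choose s) * (real T / real n) ^ s))
        \<le> \<mu> * real n ^ s / U ^ (r - 2) * (A * (real (k choose s) * ((1 + \<tau>') * U / real n) ^ s))"
      using A T_ub \<mu> U
      by (intro mult_mono m mult_left_mono power_mono divide_right_mono) auto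
    also have "\<dots> = \<mu> * A * real (k choose s) * (1 + \<tau>') ^ s * (U ^ s / U ^ (r - 2))"
      using n0 by (simp add: power_divide power_mult_distrib)
    \<comment> \<open>The powers of \<open>n\<close> have cancelled; the scaling of the number of
      constraints leaves an exponent linear in \<open>U\<close>.\<close>
    also have "U ^ s / U ^ (r - 2) = U"
    proof -
      have "s = Suc (r - 2)" using r by (simp add: s_def)
      then show ?thesis using U by simp
    qed
    finally have 1: "real m * (A * (real (k choose s) * (real T / real n) ^ s))
        \<le> \<mu> * A * real (k choose s) * (1 + \<tau>') ^ s * U" .
    have "\<tau>' * U \<le> real T + 1 - U" using T_lb by (simp add: algebra_simps)
    then have 2: "l * (\<tau>' * U) \<le> l * (real T + 1 - U)" using l by (intro mult_left_mono) auto
    have "k - s = k - r + 1" using r by (simp add: s_def)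
    then have "phi k r \<mu> l \<tau>' * U = \<mu> * A * real (k choose s) * (1 + \<tau>') ^ s * U - l * (\<tau>' * U)"
      by (simp add: phi_def A_def s_def algebra_simps)
    with 1 2 show ?thesis unfolding A_def U_def by linarith
  qed
  have "real (card ?bad) \<le> real (card (graphs n m k)) * exp (phi k r \<mu> l \<tau>' * U)"
  proof -
    have "s \<le> k" using r by (simp add: s_def)
    from card_unstoppable_le[OF this n(1) n0 l] show ?thesis
      by (rule order.trans) (use exponent in \<open>auto intro!: mult_left_mono\<close>)
  qed
  with split have "real (card (graphs n m k)) * (1 - exp (phi k r \<mu> l \<tau>' * U))
      \<le> real (card {G \<in> graphs n m k. Q G})"
    by (simp add: algebra_simps)
  then have "1 - exp (phi k r \<mu> l \<tau>' * U)
      \<le> real (card {G \<in> graphs n m k. Q G}) / real (card (graphs n m k))"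
    using pos by (simp add: field_simps)
  then show ?thesis
    by (simp add: p_stop_def graph_prob_def Q_def m_def U_def)
qed

section \<open>The exponent\<close>

text \<open>The exponential term grows at least like \<open>B * l\<^sup>2 / 2\<close>, whereas the
  subtracted term is at most \<open>l * \<tau>\<close>. Boundedness is what gives the real infimum
  its usual meaning.\<close>

lemma bdd_below_phi:
  assumes "0 < \<mu>" "r \<le> k" "1 \<le> r"
  shows "bdd_below ((\<lambda>x. phi k r \<mu> (fst x) (snd x)) ` ({0<..} \<times> {0<..<\<tau>}))"
proof -
  define B where "B = \<mu> * real (k choose (r - 1))"
  have B: "0 < B" using assms by (simp add: B_def)
  \<comment> \<open>The constant is the minimum of \<open>B * l\<^sup>2 / 2 - l * \<tau>\<close>,
    attained at \<open>l = \<tau> / B\<close>.\<close>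
  have "- (\<tau>\<^sup>2 / (2 * B)) \<le> phi k r \<mu> l t" if l: "0 < l" and t: "0 < t" "t < \<tau>" for l t
  proof -
    define c where "c = real (k - r + 1)"
    have "1 \<le> c" by (simp add: c_def)
    then have "l \<le> c * l" using l by simp
    have "1 + l + l\<^sup>2 / 2 \<le> exp l" using exp_lower_Taylor_quadratic[of l] l by simp
    also have "exp l \<le> exp (c * l)" using \<open>l \<le> c * l\<close> by simp
    finally have e: "l\<^sup>2 / 2 \<le> exp (c * l) - 1" using l by simp
    have "B * (l\<^sup>2 / 2) * 1 \<le> B * (exp (c * l) - 1) * (1 + t) ^ (r - 1)"
      using B e t by (intro mult_mono mult_left_mono one_le_power) (auto intro!: mult_nonneg_nonneg order.trans[OF _ e])
    then have "B * (l\<^sup>2 / 2) - l * t \<le> phi k r \<mu> l t"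
      by (simp add: phi_def B_def c_def mult_ac)
    moreover have "l * t \<le> l * \<tau>" using l t by simp
    moreover have "- (\<tau>\<^sup>2 / (2 * B)) \<le> B * (l\<^sup>2 / 2) - l * \<tau>"
    proof -
      have "0 \<le> (B * l - \<tau>)\<^sup>2 / (2 * B)" using B by simp
      also have "\<dots> = B * (l\<^sup>2 / 2) - l * \<tau> + \<tau>\<^sup>2 / (2 * B)"
        using B by (simp add: power2_eq_square field_simps)
      finally show ?thesis by simp
    qed
    ultimately show ?thesis by linarith
  qed
  then show ?thesis by (intro bdd_belowI[of _ "- (\<tau>\<^sup>2 / (2 * B))"]) auto
qed

text \<open>Both sides count \<open>r\<close>-subsets with a marked element. It converts the
  binomial in \<open>phi\<close> into the one in the equation for \<open>\<mu>\<close>.\<close>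

lemma choose_pred_times: "1 \<le> r \<Longrightarrow> r \<le> k \<Longrightarrow> (k - r + 1) * (k choose (r - 1)) = r * (k choose r)"
proof -
  assume *: "1 \<le> r" "r \<le> k"
  then obtain s where s: "r = Suc s" by (cases r) auto
  then obtain k' where k: "k = Suc k'" using * by (cases k) auto
  have "(k - s) * (k choose s) = k * (k' choose s)"
    using binomial_absorb_comp[of k s] k by simp
  also have "\<dots> = r * (k choose r)"
    using Suc_times_binomial_eq[of k' s] k s by (metis mult.commute)
  finally have "(k - s) * (k choose s) = r * (k choose r)" .
  moreover have "k - s = k - r + 1" "r - 1 = s" using s * by auto
  ultimately show ?thesis by (simp only:)
qed

text \<open>\<open>phi\<close> vanishes at \<open>l = 0\<close> with slope \<open>- h t\<close>
  there. Since \<open>h\<close> has a zero with positive derivative at \<open>\<tau>s\<close>, it is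
  positive just to the right, and a small \<open>l\<close> makes \<open>phi\<close>
  negative.\<close>

lemma ex_phi_neg:
  fixes \<tau>s \<tau> \<mu> :: real
  assumes r: "3 \<le> r" "r \<le> k" and \<tau>s: "0 < \<tau>s" "\<tau>s < 1 / (real r - 2)" "\<tau>s < \<tau>"
    and \<mu>: "\<mu> = (1 / real (k choose r)) * \<tau>s / (real r * (1 + \<tau>s) ^ (r - 1))"
  shows "\<exists>l>0. \<exists>t\<in>{0<..<\<tau>}. phi k r \<mu> l t < 0"
proof -
  define c where "c = real (k - r + 1)"
  define B where "B = \<mu> * real (k choose (r - 1))"
  have ch: "0 < real (k choose r)" using r by simp
  have "c * real (k choose (r - 1)) = real r * real (k choose r)"
    using choose_pred_times[of r k] r unfolding c_def by (metis of_nat_mult le_trans one_le_numeral)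
  then have "c * B = \<mu> * (real r * real (k choose r))" by (simp add: B_def mult_ac)
  then have cB: "c * B = \<tau>s / (1 + \<tau>s) ^ (r - 1)"
    using ch r by (simp add: \<mu>)
  \<comment> \<open>Here \<open>s\<close> is \<open>r - 2\<close>, the exponent left after
    differentiating \<open>(1 + t) ^ (r - 1)\<close>.\<close>
  obtain s where s: "r = Suc (Suc s)" "0 < s" using r by (cases r rule: nat.exhaust; cases "r - 1") auto
  define h where "h t = t - c * B * (1 + t) ^ (r - 1)" for t
  have h0: "h \<tau>s = 0" using \<tau>s by (simp add: h_def cB)
  have "(h has_real_derivative 1 - c * B * (real (r - 1) * (1 + \<tau>s) ^ s)) (at \<tau>s)"
  proof -
    have "r - 1 - Suc 0 = s" using s by simp
    then show ?thesis unfolding h_def by (auto intro!: derivative_eq_intros)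
  qed
  moreover have "c * B * (real (r - 1) * (1 + \<tau>s) ^ s) = \<tau>s * real (r - 1) / (1 + \<tau>s)"
  proof -
    have "r - 1 = Suc s" using s by simp
    moreover have "0 < (1 + \<tau>s) ^ s" using \<tau>s by simp
    ultimately show ?thesis unfolding cB using \<tau>s by simp
  qed
  \<comment> \<open>Equivalent to \<open>\<tau>s * (r - 2) < 1\<close>: this selects the root on the
    branch where \<open>h\<close> increases.\<close>
  moreover have "\<tau>s * real (r - 1) / (1 + \<tau>s) < 1"
  proof -
    have "\<tau>s * real s < 1" using \<tau>s s by (simp add: field_simps)
    then show ?thesis using \<tau>s s by (simp add: field_simps)
  qed
  ultimately obtain d where d: "0 < d" "\<And>e. 0 < e \<Longrightarrow> e < d \<Longrightarrow> h \<tau>s < h (\<tau>s + e)"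
    using DERIV_pos_inc_right[of h _ \<tau>s] by (metis diff_gt_0_iff_gt)
  define e where "e = min d (\<tau> - \<tau>s) / 2"
  have e: "0 < e" "e < d" "e < \<tau> - \<tau>s" using d(1) \<tau>s by (auto simp: e_def min_def)
  define t where "t = \<tau>s + e"
  have t: "t \<in> {0<..<\<tau>}" using e \<tau>s by (simp add: t_def)
  have ht: "0 < h t" using d(2)[OF e(1,2)] h0 by (simp add: t_def)
  have phi: "phi k r \<mu> l t = B * (exp (c * l) - 1) * (1 + t) ^ (r - 1) - l * t" for l
    by (simp add: phi_def B_def c_def mult_ac)
  have "((\<lambda>l. phi k r \<mu> l t) has_real_derivative - h t) (at 0)"
    unfolding phi by (auto intro!: derivative_eq_intros simp: h_def)
  then obtain d' where d': "0 < d'" "\<And>e. 0 < e \<Longrightarrow> e < d' \<Longrightarrow> phi k r \<mu> (0 + e) t < phi k r \<mu> 0 t"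
    using DERIV_neg_dec_right[of "\<lambda>l. phi k r \<mu> l t" "- h t" 0] ht by auto
  have "phi k r \<mu> 0 t = 0" by (simp add: phi)
  then have "phi k r \<mu> (d' / 2) t < 0" using d'(2)[of "d' / 2"] d'(1) by simp
  with d'(1) t show ?thesis by (intro exI[of _ "d' / 2"]) auto
qed

section \<open>Passage to the infimum and to the limit\<close>

lemma p_stop_le_1: "p_stop k r u \<mu> \<tau> n \<le> 1"
proof -
  have "real (card {G \<in> graphs n m k. P G}) \<le> real (card (graphs n m k))" for m P
    by (intro of_nat_mono card_mono) (auto simp: finite_graphs)
  then show ?thesis
    unfolding p_stop_def graph_prob_def by (intro divide_le_eq_1[THEN iffD2]) (auto simp: not_less)
qed

theorem mainTheorem6:
  fixes k r :: nat and u :: "nat \<Rightarrow> nat" and \<mu> \<tau>s \<tau> :: real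
  assumes "3 \<le> r" and "r \<le> k"
    and "filterlim u at_top sequentially"
    and "(\<lambda>n. real (u n) / real n) \<longlonglongrightarrow> 0"
    and "0 < \<mu>" and "\<mu> < mu_c k r"
    and "0 < \<tau>s" and "\<tau>s < 1 / (real r - 2)"
    and "\<mu> = (1 / real (k choose r)) * \<tau>s / (real r * (1 + \<tau>s) ^ (r - 1))"
    and "\<tau>s < \<tau>"
  shows "(p_stop k r u \<mu> \<tau> \<longlonglongrightarrow> 1) \<and>
    (\<exists>C N. \<forall>n\<ge>N. p_stop k r u \<mu> \<tau> n \<ge>
       1 - exp ((INF x\<in>{0<..} \<times> {0<..<\<tau>}. phi k r \<mu> (fst x) (snd x)) * real (u n)
                + C * max 1 (real (u n) ^ 2 / real n)))"
proof -
  define I where "I = (INF x\<in>{0<..} \<times> {0<..<\<tau>}. phi k r \<mu> (fst x) (snd x))"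
  obtain l t where lt: "0 < l" "t \<in> {0<..<\<tau>}" "phi k r \<mu> l t < 0"
    using ex_phi_neg[OF assms(1,2,7,8,10,9)] by blast
  have bdd: "bdd_below ((\<lambda>x. phi k r \<mu> (fst x) (snd x)) ` ({0<..} \<times> {0<..<\<tau>}))"
    using assms by (intro bdd_below_phi) auto
  have "I \<le> phi k r \<mu> l t"
    unfolding I_def using cINF_lower[OF bdd, of "(l, t)"] lt by simp
  then have I_neg: "I < 0" using lt by simp
  have "0 < \<tau>" using assms by simp
  have ev: "\<forall>\<^sub>F n in sequentially. 1 - exp (I * real (u n)) \<le> p_stop k r u \<mu> \<tau> n"
  proof -
    have u_pos: "\<forall>\<^sub>F n in sequentially. 1 \<le> u n"
      using assms(3) by (auto simp: filterlim_at_top)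
    moreover have "\<forall>\<^sub>F n in sequentially. real (u n) / real n < 1 / (1 + \<tau>)"
      using assms(4) \<open>0 < \<tau>\<close> by (intro order_tendstoD(2)) auto
    ultimately show ?thesis using eventually_ge_at_top[of k]
    proof eventually_elim
      case (elim n)
      then have n: "0 < u n" "k \<le> n" "0 < n" using assms(1,2) by auto
      have u: "(1 + \<tau>) * real (u n) \<le> real n"
        using elim(2) \<open>0 < \<tau>\<close> n by (simp add: field_simps)
      define p where "p = p_stop k r u \<mu> \<tau> n"
      have each: "1 - p \<le> exp (phi k r \<mu> l t * real (u n))"
        if "0 < l" "t \<in> {0<..<\<tau>}" for l t
        using p_stop_ge[of r k n u \<tau> \<mu> l t] assms(1,2,5) n u that
        by (simp add: p_def algebra_simps)
      show ?case
      \<comment> \<open>The infimum need not be attained, so logarithms turn the bounds into one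
        lower bound for all values of \<open>phi\<close>. This needs \<open>1 - p > 0\<close>;
        otherwise the claim is immediate.\<close>
      proof (cases "p < 1")
        case True
        have "ln (1 - p) / real (u n) \<le> I"
          unfolding I_def
        proof (rule cINF_greatest)
          fix x :: "real \<times> real" assume "x \<in> {0<..} \<times> {0<..<\<tau>}"
          then have "ln (1 - p) \<le> ln (exp (phi k r \<mu> (fst x) (snd x) * real (u n)))"
            using each[of "fst x" "snd x"] True by (intro ln_mono) auto
          then show "ln (1 - p) / real (u n) \<le> phi k r \<mu> (fst x) (snd x)"
            using n by (simp add: field_simps)
        qed (use lt in auto)
        then have "ln (1 - p) \<le> I * real (u n)" using n by (simp add: field_simps)
        then have "1 - p \<le> exp (I * real (u n))"
          using True by (metis diff_gt_0_iff_gt exp_le_cancel_iff exp_ln)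
        then show ?thesis by (simp add: p_def)
      next
        case False
        then show ?thesis unfolding p_def by (smt (verit) exp_gt_zero)
      qed
    qed
  qed
  have "p_stop k r u \<mu> \<tau> \<longlonglongrightarrow> 1"
  proof (rule tendsto_sandwich[OF ev])
    show "\<forall>\<^sub>F n in sequentially. p_stop k r u \<mu> \<tau> n \<le> 1"
      by (simp add: p_stop_le_1)
    have "filterlim (\<lambda>n. real (u n)) at_top sequentially"
      by (rule filterlim_compose[OF filterlim_real_sequentially assms(3)])
    then have "filterlim (\<lambda>n. I * real (u n)) at_bot sequentially"
      by (rule filterlim_tendsto_neg_mult_at_bot[OF tendsto_const I_neg])
    then have "(\<lambda>n. exp (I * real (u n))) \<longlonglongrightarrow> 0"
      by (rule filterlim_compose[OF exp_at_bot])
    then show "(\<lambda>n. 1 - exp (I * real (u n))) \<longlonglongrightarrow> 1"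
      using tendsto_diff[OF tendsto_const[of 1]] by fastforce
  qed simp
  moreover obtain N where "\<forall>n\<ge>N. 1 - exp (I * real (u n)) \<le> p_stop k r u \<mu> \<tau> n"
    using ev by (auto simp: eventually_sequentially)
  \<comment> \<open>The witness for the error constant is \<open>C = 0\<close>.\<close>
  then have "\<forall>n\<ge>N. p_stop k r u \<mu> \<tau> n
      \<ge> 1 - exp (I * real (u n) + 0 * max 1 (real (u n) ^ 2 / real n))" by simp
  ultimately show ?thesis unfolding I_def by blast
qed

end
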